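(* Let $r,s\ge 1$ be integers and let $0\le a_1\le\dots\le a_r$ be integers with $\sum_{i=1}^r a_i\le s$, so that $X=\mathbb{P}\left(\mathcal{O}_{\mathbb{P}^s}\oplus\bigoplus_{i=1}^r\mathcal{O}_{\mathbb{P}^s}(a_i)\right)$ is a Fano projective bundle. For real $t$ let $$f_t(z,w)=\sum_{i=1}^s z_i+\sum_{i=1}^r w_i+e^{t}\,\frac{w_1^{a_1}\cdots w_r^{a_r}}{z_1\cdots z_s}+\frac{1}{w_1\cdots w_r},$$ let $Crit(X;f_t)\subset(\mathbb{C}^* )^{s+r}$ be its set of critical points, and let $\Theta:(\mathbb{C}^* )^{s+r}\to\mathbb{T}^2$ be the map $$\Theta(z_1,\dots,z_s,w_1,\dots,w_r)=Arg\left(\frac{\prod_{i=1}^r w_i^{a_i}}{\prod_{i=1}^s z_i},\ \frac{1}{\prod_{i=1}^r w_i}\right).$$ Then $$\lim_{t\to-\infty}\Theta\big(Crit(X;f_t)\big)=\left\{\left(e^{2\pi i\left(\frac{l\sum_{j=1}^r a_j}{(s+1)(r+1)}+\frac{k}{s+1}\right)},\ e^{\frac{2\pi i l}{r+1}}\right)\ :\ 0\le k\le s,\ 0\le l\le r\right\}\subset\mathbb{T}^2 .$$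
   Context: $\mathbb{T}=\{\zeta\in\mathbb{C}:|\zeta|=1\}$, and $Arg:(\mathbb{C}^* )^2\to\mathbb{T}^2$ is $Arg(x,y)=(x/|x|,\,y/|y|)$. The solution scheme $Crit(X;f_t)$ is the set of $(z,w)\in(\mathbb{C}^* )^{s+r}$ solving the Landau-Ginzburg system $z_i\frac{\partial f_t}{\partial z_i}=0$ for $1\le i\le s$ and $w_j\frac{\partial f_t}{\partial w_j}=0$ for $1\le j\le r$. Here $t$ is a real parameter, and the limit as $t\to-\infty$ is the limit of subsets of the compact torus $\mathbb{T}^2$ (e.g. with respect to Hausdorff distance). *)

theory Defs
  imports "HOL-Analysis.Analysis"
begin

text \<open>
  Points of \<open>(\<complex>\<^sup>*)\<^sup>n\<close> are functions on the index set \<open>{1..n}\<close>, made canonical by requiring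
  the value \<^term>\<open>undefined\<close> outside of it.
\<close>

definition cstar_pow :: "nat \<Rightarrow> (nat \<Rightarrow> complex) set" where
  "cstar_pow n = ({1..n} \<rightarrow>\<^sub>E (UNIV - {0}))"

definition torus2 :: "(complex \<times> complex) set" where
  "torus2 = sphere 0 1 \<times> sphere 0 1"

text \<open>Not to be confused with the real-valued library constant \<^const>\<open>Arg\<close>.\<close>

definition arg_map :: "complex \<times> complex \<Rightarrow> complex \<times> complex" where
  "arg_map = (\<lambda>(x, y). (x / of_real (cmod x), y / of_real (cmod y)))"

definition LG_potential ::
  "nat \<Rightarrow> nat \<Rightarrow> (nat \<Rightarrow> nat) \<Rightarrow> real \<Rightarrow> (nat \<Rightarrow> complex) \<Rightarrow> (nat \<Rightarrow> complex) \<Rightarrow> complex"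
where
  "LG_potential s r a t z w =
     (\<Sum>i=1..s. z i) + (\<Sum>i=1..r. w i)
     + of_real (exp t) * (\<Prod>i=1..r. w i ^ a i) / (\<Prod>i=1..s. z i)
     + 1 / (\<Prod>i=1..r. w i)"

definition LG_crit ::
  "nat \<Rightarrow> nat \<Rightarrow> (nat \<Rightarrow> nat) \<Rightarrow> real \<Rightarrow> ((nat \<Rightarrow> complex) \<times> (nat \<Rightarrow> complex)) set"
where
  "LG_crit s r a t =
     {(z, w). z \<in> cstar_pow s \<and> w \<in> cstar_pow r \<and>
        (\<forall>i\<in>{1..s}. z i * deriv (\<lambda>x. LG_potential s r a t (z(i := x)) w) (z i) = 0) \<and>
        (\<forall>j\<in>{1..r}. w j * deriv (\<lambda>x. LG_potential s r a t z (w(j := x))) (w j) = 0)}"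

definition Theta ::
  "nat \<Rightarrow> nat \<Rightarrow> (nat \<Rightarrow> nat) \<Rightarrow> (nat \<Rightarrow> complex) \<times> (nat \<Rightarrow> complex) \<Rightarrow> complex \<times> complex"
where
  "Theta s r a = (\<lambda>(z, w).
     arg_map ((\<Prod>i=1..r. w i ^ a i) / (\<Prod>i=1..s. z i), 1 / (\<Prod>i=1..r. w i)))"

text \<open>
  Taking values in \<^typ>\<open>ennreal\<close> makes the suprema and infima meaningful for all sets; in
  particular the distance from the empty set to a nonempty set is \<open>\<infinity>\<close>.
\<close>

definition hausdorff_dist :: "'a::metric_space set \<Rightarrow> 'a set \<Rightarrow> ennreal" where
  "hausdorff_dist A B =
     max (SUP x\<in>A. INF y\<in>B. ennreal (dist x y)) (SUP y\<in>B. INF x\<in>A. ennreal (dist x y))"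

definition limit_set :: "nat \<Rightarrow> nat \<Rightarrow> (nat \<Rightarrow> nat) \<Rightarrow> (complex \<times> complex) set" where
  "limit_set s r a =
     {(exp (2 * of_real pi * \<i> * (of_nat l * of_nat (\<Sum>j=1..r. a j)
                                     / (of_nat (s + 1) * of_nat (r + 1))
                                   + of_nat k / of_nat (s + 1))),
       exp (2 * of_real pi * \<i> * of_nat l / of_nat (r + 1))) | k l. k \<le> s \<and> l \<le> r}"

end

theory Submission
  imports Defs
begin

text \<open>
  In logarithmic form the critical equations read \<open>z\<^sub>i = u\<close> for all \<open>i\<close> and
  \<open>w\<^sub>j = v - a\<^sub>j u\<close> for all \<open>j\<close>, where \<open>u = e\<^sup>t \<Prod> w\<^sub>j^a\<^sub>j / \<Prod> z\<^sub>i\<close> and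
  \<open>v = 1 / \<Prod> w\<^sub>j\<close>. Hence critical points amount to solutions \<open>(u, v)\<close> of
  \<open>u^(s+1) = e\<^sup>t \<Prod> (v - a\<^sub>j u)^a\<^sub>j\<close> and \<open>v \<Prod> (v - a\<^sub>j u) = 1\<close>, and \<open>\<Theta>\<close> sends such a point to
  the pair of phases of \<open>u\<close> and \<open>v\<close> (\<open>Theta_LG_crit\<close>). If \<open>u\<close> is negligible against \<open>v\<close>, the
  second equation says \<open>v^(r+1) \<approx> 1\<close> and the first \<open>(phase of u)^(s+1) \<approx> (phase of v)^A\<close> with
  \<open>A = \<Sum> a\<^sub>j\<close>; the exact solutions of these limiting equations are the \<open>(s+1)(r+1)\<close> points of
  the claimed limit (\<open>limit_set_eq_root_pairs\<close>).

  To make this precise put \<open>\<delta> = exp (t / (s+1))\<close> and \<open>x = u / v\<close>. The Fano bound \<open>A \<le> s\<close> enters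
  through a degree comparison: it gives \<open>|x| \<le> \<delta> (1 + s |x|)\<close>, so that \<open>x\<close> tends to \<open>0\<close>
  uniformly over all critical points as \<open>t \<rightarrow> -\<infinity>\<close> (\<open>reduced_sols_norm_le\<close>,
  \<open>reduced_sols_ratio_small\<close>). For small \<open>x\<close> all factors \<open>1 - a\<^sub>j x\<close> have principal logarithms,
  and there are functions \<open>E\<close> and \<open>F\<close>, continuous near \<open>0\<close> and vanishing at \<open>0\<close>, such that the
  substitution \<open>u = \<delta> \<alpha> exp (E x)\<close>, \<open>v = \<beta> exp (F x)\<close> turns the system exactly into
  \<open>\<beta>^(r+1) = 1\<close>, \<open>\<alpha>^(s+1) = \<beta>^A\<close> (\<open>reduced_sols_iff_root_pairs\<close>). So every critical point lies
  over a limit point \<open>(\<alpha>, \<beta>)\<close>, from which its phases differ by those of \<open>exp (E x)\<close> and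
  \<open>exp (F x)\<close>, which are close to \<open>1\<close>. Conversely, over each limit point there is a critical
  point as soon as \<open>x = \<delta> (\<alpha> / \<beta>) exp (E x - F x)\<close> has a small solution, and Brouwer's theorem
  provides one when \<open>\<delta>\<close> is small (\<open>small_fixed_point\<close>).
\<close>

section \<open>The Hausdorff distance\<close>

lemma hausdorff_dist_le:
  assumes "\<And>x. x \<in> A \<Longrightarrow> \<exists>y\<in>B. dist x y \<le> e" and "\<And>y. y \<in> B \<Longrightarrow> \<exists>x\<in>A. dist x y \<le> e"
  shows "hausdorff_dist A B \<le> ennreal e"
proof -
  have "(INF y\<in>B. ennreal (dist x y)) \<le> ennreal e" if "x \<in> A" for x
    using assms(1)[OF that] by (meson INF_lower2 ennreal_leI)
  moreover have "(INF x\<in>A. ennreal (dist x y)) \<le> ennreal e" if "y \<in> B" for y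
    using assms(2)[OF that] by (meson INF_lower2 ennreal_leI)
  ultimately show ?thesis
    unfolding hausdorff_dist_def by (auto intro!: SUP_least)
qed

section \<open>The limit set as the solution set of two monomial equations\<close>

definition root_pairs :: "nat \<Rightarrow> nat \<Rightarrow> nat \<Rightarrow> (complex \<times> complex) set" where
  "root_pairs s r A = {(\<alpha>, \<beta>). \<alpha> ^ (s + 1) = \<beta> ^ A \<and> \<beta> ^ (r + 1) = 1}"

lemma norm_root_pairs:
  assumes "(\<alpha>, \<beta>) \<in> root_pairs s r A"
  shows "cmod \<alpha> = 1" "cmod \<beta> = 1"
proof -
  have eqs: "\<alpha> ^ (s + 1) = \<beta> ^ A" "\<beta> ^ (r + 1) = 1"
    using assms by (simp_all add: root_pairs_def)
  have root: "x = 1" if "x ^ (n + 1) = 1" "x \<ge> 0" for x :: real and n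
    by (rule power_eq_imp_eq_base[of x "n + 1"]) (use that in auto)
  have "cmod \<beta> ^ (r + 1) = 1"
    unfolding norm_power[symmetric] eqs(2) by simp
  then show b: "cmod \<beta> = 1" by (rule root) simp
  have "cmod \<alpha> ^ (s + 1) = 1"
    unfolding norm_power[symmetric] eqs(1) by (simp add: norm_power b)
  then show "cmod \<alpha> = 1" by (rule root) simp
qed

text \<open>
  The index \<open>l\<close> selects the root of unity \<open>\<beta>\<close>. The phase with \<open>k = 0\<close> is one particular
  \<open>(s+1)\<close>-st root of \<open>\<beta>^A\<close>, and \<open>k\<close> runs through the others by way of the \<open>(s+1)\<close>-st roots of
  unity.
\<close>

lemma limit_set_eq_root_pairs: "limit_set s r a = root_pairs s r (\<Sum>j=1..r. a j)"
proof -
  define A where "A = (\<Sum>j=1..r. a j)"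
  define al where "al = (\<lambda>k l. exp (2 * of_real pi * \<i> * (of_nat l * of_nat A
       / (of_nat (s + 1) * of_nat (r + 1)) + of_nat k / of_nat (s + 1))) :: complex)"
  define be where "be = (\<lambda>l. exp (2 * of_real pi * \<i> * of_nat l / of_nat (r + 1)) :: complex)"
  define om where "om = (\<lambda>k. exp (2 * of_real pi * \<i> * of_nat k / of_nat (s + 1)) :: complex)"
  have roots: "z ^ (n + 1) = 1 \<longleftrightarrow> (\<exists>k\<le>n. z = exp (2 * of_real pi * \<i> * of_nat k / of_nat (n + 1)))"
    for z :: complex and n
    using complex_roots_unity[of "n + 1"] by (force simp: less_Suc_eq_le)
  have al_split: "al k l = al 0 l * om k" for k l
    unfolding al_def om_def exp_add[symmetric] by (simp add: ring_distribs del: of_nat_add)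
  have al0: "al 0 l ^ (s + 1) = be l ^ A" for l
  proof -
    have cancel: "N * (c * (m * q / (N * R) + of_nat 0 / N)) = q * (c * m / R)"
      if "N \<noteq> 0" "R \<noteq> 0" for N R c m q :: complex
      using that by simp
    have "of_nat (s + 1) \<noteq> (0::complex)" "of_nat (r + 1) \<noteq> (0::complex)"
      by (simp_all del: of_nat_add of_nat_Suc)
    then have "of_nat (s + 1) * (2 * of_real pi * \<i> * (of_nat l * of_nat A
       / (of_nat (s + 1) * of_nat (r + 1)) + of_nat 0 / of_nat (s + 1)))
       = (of_nat A * (2 * of_real pi * \<i> * of_nat l / of_nat (r + 1)) :: complex)"
      using cancel by blast
    then show ?thesis
      unfolding al_def be_def exp_of_nat_mult[symmetric] by simp
  qed
  have om1: "om k ^ (s + 1) = 1" if "k \<le> s" for k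
    using roots[of "om k" s] that om_def by blast
  have be1: "be l ^ (r + 1) = 1" if "l \<le> r" for l
    using roots[of "be l" r] that be_def by blast
  have "limit_set s r a = {(al k l, be l) | k l. k \<le> s \<and> l \<le> r}"
    unfolding limit_set_def al_def be_def A_def ..
  also have "\<dots> = root_pairs s r A"
  proof (intro equalityI subsetI)
    fix p assume "p \<in> {(al k l, be l) | k l. k \<le> s \<and> l \<le> r}"
    then obtain k l where p: "p = (al k l, be l)" "k \<le> s" "l \<le> r" by blast
    have "al k l ^ (s + 1) = be l ^ A"
      unfolding al_split[of k l] power_mult_distrib al0 om1[OF p(2)] by simp
    then show "p \<in> root_pairs s r A"
      unfolding p(1) root_pairs_def using be1[OF p(3)] by blast
  next
    fix p assume "p \<in> root_pairs s r A"
    then obtain \<alpha> \<beta> where p: "p = (\<alpha>, \<beta>)" "\<alpha> ^ (s + 1) = \<beta> ^ A" "\<beta> ^ (r + 1) = 1"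
      by (auto simp: root_pairs_def)
    then obtain l where l: "l \<le> r" "\<beta> = be l"
      using roots[of \<beta> r] be_def by blast
    have nz: "al 0 l \<noteq> 0" "be l \<noteq> 0" by (simp_all add: al_def be_def)
    have "(\<alpha> / al 0 l) ^ (s + 1) = 1"
      unfolding power_divide al0 p(2) l(2) using nz by simp
    then obtain k where k: "k \<le> s" "\<alpha> / al 0 l = om k"
      using roots[of "\<alpha> / al 0 l" s] om_def by blast
    then have "\<alpha> = al k l"
      unfolding al_split[of k l] using nz by (metis nonzero_mult_div_cancel_left times_divide_eq_right)
    then show "p \<in> {(al k l, be l) | k l. k \<le> s \<and> l \<le> r}"
      using p l k by blast
  qed
  finally show ?thesis by (simp add: A_def)
qed

section \<open>Reduction of the critical equations to two unknowns\<close>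

text \<open>
  The critical equations in the two unknowns \<open>u\<close>, the common value of the \<open>z\<^sub>i\<close>, and
  \<open>v = 1 / \<Prod> w\<^sub>j\<close>, with \<open>\<epsilon>\<close> standing for \<open>e\<^sup>t\<close>. That \<open>u\<close>, \<open>v\<close> and all \<open>w\<^sub>j = v - a\<^sub>j u\<close> are
  nonzero follows from the equations when \<open>\<epsilon> \<noteq> 0\<close>.
\<close>

definition reduced_sols :: "nat \<Rightarrow> nat \<Rightarrow> (nat \<Rightarrow> nat) \<Rightarrow> real \<Rightarrow> (complex \<times> complex) set" where
  "reduced_sols s r a \<epsilon> =
     {(u, v). u ^ (s + 1) = of_real \<epsilon> * (\<Prod>j=1..r. (v - of_nat (a j) * u) ^ a j) \<and>
              v * (\<Prod>j=1..r. v - of_nat (a j) * u) = 1}"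

text \<open>
  As a function of one coordinate \<open>x = z\<^sub>i\<close> the potential is \<open>c + x + C / x\<close>, and the Euler
  operator \<open>x d/dx\<close> sends the last term to its negative.
\<close>

lemma deriv_potential_z:
  assumes "i \<in> {1..s}" "z i \<noteq> 0"
  shows "z i * deriv (\<lambda>x. LG_potential s r a t (z(i := x)) w) (z i)
       = z i - of_real (exp t) * (\<Prod>j=1..r. w j ^ a j) / (\<Prod>k=1..s. z k)"
proof -
  let ?I = "{1..s} - {i}"
  define W where "W = of_real (exp t) * (\<Prod>j=1..r. w j ^ a j)"
  define P where "P = (\<Prod>k\<in>?I. z k)"
  define C where "C = W / P"
  define c where "c = (\<Sum>k\<in>?I. z k) + (\<Sum>j=1..r. w j) + 1 / (\<Prod>j=1..r. w j)"
  have s: "(\<Sum>k=1..s. (z(i := x)) k) = x + (\<Sum>k\<in>?I. z k)" for x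
    using assms by (subst sum.remove[of _ i]) (auto intro!: sum.cong)
  have p: "(\<Prod>k=1..s. (z(i := x)) k) = x * P" for x
    using assms unfolding P_def by (subst prod.remove[of _ i]) (auto intro!: prod.cong)
  have f: "(\<lambda>x. LG_potential s r a t (z(i := x)) w) = (\<lambda>x. c + x + C / x)"
    unfolding LG_potential_def s p c_def C_def W_def by (auto simp: field_simps)
  have "((\<lambda>x. c + x + C / x) has_field_derivative 1 - C / (z i)\<^sup>2) (at (z i))"
    using assms(2) by (auto intro!: derivative_eq_intros simp: power2_eq_square)
  then have "deriv (\<lambda>x. LG_potential s r a t (z(i := x)) w) (z i) = 1 - C / (z i)\<^sup>2"
    unfolding f by (rule DERIV_imp_deriv)
  moreover have "(\<Prod>k=1..s. z k) = z i * P"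
    using p[of "z i"] by simp
  ultimately show ?thesis
    unfolding W_def[symmetric] C_def using assms(2)
    by (simp add: right_diff_distrib power2_eq_square ac_simps)
qed

text \<open>
  As a function of one coordinate \<open>x = w\<^sub>j\<close> the potential is \<open>c + x + K x^a\<^sub>j + C / x\<close>; the
  Euler operator \<open>x d/dx\<close> multiplies each monomial by its exponent.
\<close>

lemma deriv_potential_w:
  assumes "j \<in> {1..r}" "w j \<noteq> 0"
  shows "w j * deriv (\<lambda>x. LG_potential s r a t z (w(j := x))) (w j)
       = w j + of_nat (a j) * (of_real (exp t) * (\<Prod>k=1..r. w k ^ a k) / (\<Prod>k=1..s. z k))
             - 1 / (\<Prod>k=1..r. w k)"
proof -
  let ?I = "{1..r} - {j}"
  define Z where "Z = (\<Prod>k=1..s. z k)"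
  define Q where "Q = (\<Prod>k\<in>?I. w k ^ a k)"
  define P where "P = (\<Prod>k\<in>?I. w k)"
  define K where "K = of_real (exp t) * Q / Z"
  define C where "C = 1 / P"
  define c where "c = (\<Sum>k=1..s. z k) + (\<Sum>k\<in>?I. w k)"
  have s: "(\<Sum>k=1..r. (w(j := x)) k) = x + (\<Sum>k\<in>?I. w k)" for x
    using assms by (subst sum.remove[of _ j]) (auto intro!: sum.cong)
  have p: "(\<Prod>k=1..r. (w(j := x)) k) = x * P" for x
    using assms unfolding P_def by (subst prod.remove[of _ j]) (auto intro!: prod.cong)
  have q: "(\<Prod>k=1..r. (w(j := x)) k ^ a k) = x ^ a j * Q" for x
    using assms unfolding Q_def by (subst prod.remove[of _ j]) (auto intro!: prod.cong)
  have f: "(\<lambda>x. LG_potential s r a t z (w(j := x))) = (\<lambda>x. c + x + K * x ^ a j + C / x)"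
    unfolding LG_potential_def s p q c_def C_def K_def Z_def by (auto simp: field_simps)
  have "((\<lambda>x. c + x + K * x ^ a j + C / x) has_field_derivative
          1 + K * (of_nat (a j) * w j ^ (a j - 1)) - C / (w j)\<^sup>2) (at (w j))"
    using assms(2) by (auto intro!: derivative_eq_intros simp: power2_eq_square)
  then have d: "deriv (\<lambda>x. LG_potential s r a t z (w(j := x))) (w j) =
      1 + K * (of_nat (a j) * w j ^ (a j - 1)) - C / (w j)\<^sup>2"
    unfolding f by (rule DERIV_imp_deriv)
  \<comment> \<open>For \<open>a j = 0\<close> both sides vanish, whatever the truncated exponent \<open>a j - 1\<close> is.\<close>
  have e: "w j * (K * (of_nat (a j) * w j ^ (a j - 1))) = of_nat (a j) * (K * w j ^ a j)"
    by (cases "a j") auto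
  have p': "(\<Prod>k=1..r. w k) = w j * P" and q': "(\<Prod>k=1..r. w k ^ a k) = w j ^ a j * Q"
    using p[of "w j"] q[of "w j"] by simp_all
  have "w j * deriv (\<lambda>x. LG_potential s r a t z (w(j := x))) (w j)
      = w j + of_nat (a j) * (K * w j ^ a j) - 1 / (w j * P)"
    unfolding d ring_distribs right_diff_distrib e using assms(2)
    by (simp add: C_def power2_eq_square)
  then show ?thesis
    unfolding p' q' K_def Z_def by (simp add: ac_simps)
qed

lemma LG_crit_iff:
  "(z, w) \<in> LG_crit s r a t \<longleftrightarrow> z \<in> cstar_pow s \<and> w \<in> cstar_pow r \<and>
     (\<forall>i\<in>{1..s}. z i = of_real (exp t) * (\<Prod>k=1..r. w k ^ a k) / (\<Prod>k=1..s. z k)) \<and>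
     (\<forall>j\<in>{1..r}. w j = 1 / (\<Prod>k=1..r. w k)
        - of_nat (a j) * (of_real (exp t) * (\<Prod>k=1..r. w k ^ a k) / (\<Prod>k=1..s. z k)))"
proof (cases "z \<in> cstar_pow s \<and> w \<in> cstar_pow r")
  case True
  then have z0: "z i \<noteq> 0" if "i \<in> {1..s}" for i using that by (auto simp: cstar_pow_def PiE_iff)
  have w0: "w i \<noteq> 0" if "i \<in> {1..r}" for i using that True by (auto simp: cstar_pow_def PiE_iff)
  have
    "z i * deriv (\<lambda>x. LG_potential s r a t (z(i := x)) w) (z i) = 0 \<longleftrightarrow>
      z i = of_real (exp t) * (\<Prod>k=1..r. w k ^ a k) / (\<Prod>k=1..s. z k)" if "i \<in> {1..s}" for i
    unfolding deriv_potential_z[where z = z, OF that z0[OF that]] by simp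
  moreover have
    "w j * deriv (\<lambda>x. LG_potential s r a t z (w(j := x))) (w j) = 0 \<longleftrightarrow>
      w j = 1 / (\<Prod>k=1..r. w k)
        - of_nat (a j) * (of_real (exp t) * (\<Prod>k=1..r. w k ^ a k) / (\<Prod>k=1..s. z k))"
    if "j \<in> {1..r}" for j
    unfolding deriv_potential_w[where w = w, OF that w0[OF that]] by (simp add: eq_diff_eq)
  ultimately show ?thesis
    using True unfolding LG_crit_def mem_Collect_eq case_prod_conv
    by (intro conj_cong ball_cong refl) blast+
next
  case False
  then show ?thesis by (auto simp: LG_crit_def)
qed

text \<open>
  Since \<open>e\<^sup>t\<close> is positive, \<open>u = e\<^sup>t \<Prod> w\<^sub>j^a\<^sub>j / \<Prod> z\<^sub>i\<close> has the same phase as the first argument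
  of \<open>Arg\<close> in the definition of \<open>\<Theta>\<close>.
\<close>

lemma Theta_LG_crit:
  "Theta s r a ` LG_crit s r a t = map_prod sgn sgn ` reduced_sols s r a (exp t)"
proof (intro equalityI subsetI)
  fix p assume "p \<in> Theta s r a ` LG_crit s r a t"
  then obtain z w where zw: "(z, w) \<in> LG_crit s r a t" and p: "p = Theta s r a (z, w)" by auto
  define W where "W = (\<Prod>k=1..r. w k ^ a k)"
  define Z where "Z = (\<Prod>k=1..s. z k)"
  define u where "u = of_real (exp t) * W / Z"
  define v where "v = 1 / (\<Prod>k=1..r. w k)"
  have zs: "\<And>i. i \<in> {1..s} \<Longrightarrow> z i = u" and ws: "\<And>j. j \<in> {1..r} \<Longrightarrow> w j = v - of_nat (a j) * u"
    using zw[unfolded LG_crit_iff, folded W_def Z_def, folded u_def v_def] by blast+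
  have nz: "Z \<noteq> 0" "(\<Prod>k=1..r. w k) \<noteq> 0"
  proof -
    have "z \<in> cstar_pow s" "w \<in> cstar_pow r" using zw by (simp_all add: LG_crit_def)
    then show "Z \<noteq> 0" "(\<Prod>k=1..r. w k) \<noteq> 0" by (auto simp: Z_def cstar_pow_def PiE_iff)
  qed
  have "Z = u ^ s" unfolding Z_def using zs by simp
  moreover have "u * Z = of_real (exp t) * W"
    unfolding u_def using nz by simp
  ultimately have "u ^ (s + 1) = of_real (exp t) * W"
    by simp
  moreover have "W = (\<Prod>j=1..r. (v - of_nat (a j) * u) ^ a j)"
    unfolding W_def using ws by (intro prod.cong) auto
  moreover have "v * (\<Prod>j=1..r. v - of_nat (a j) * u) = 1"
  proof -
    have "(\<Prod>j=1..r. v - of_nat (a j) * u) = (\<Prod>k=1..r. w k)"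
      using ws by (intro prod.cong) auto
    then show ?thesis using nz by (simp add: v_def)
  qed
  ultimately have "(u, v) \<in> reduced_sols s r a (exp t)" by (simp add: reduced_sols_def)
  moreover have "p = map_prod sgn sgn (u, v)"
  proof -
    have "p = (sgn (W / Z), sgn v)"
      by (simp add: p Theta_def arg_map_def W_def Z_def v_def sgn_eq)
    moreover have "sgn u = sgn (W / Z)"
      unfolding u_def times_divide_eq_right[symmetric] by (simp add: sgn_mult sgn_of_real)
    ultimately show ?thesis by simp
  qed
  ultimately show "p \<in> map_prod sgn sgn ` reduced_sols s r a (exp t)" by blast
next
  fix p assume "p \<in> map_prod sgn sgn ` reduced_sols s r a (exp t)"
  then obtain u v where p: "p = (sgn u, sgn v)"
    and u: "u ^ (s + 1) = of_real (exp t) * (\<Prod>j=1..r. (v - of_nat (a j) * u) ^ a j)"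
    and v: "v * (\<Prod>j=1..r. v - of_nat (a j) * u) = 1"
    by (auto simp: reduced_sols_def)
  define z where "z = (\<lambda>i\<in>{1..s}. u)"
  define w where "w = (\<lambda>j\<in>{1..r}. v - of_nat (a j) * u)"
  have nzw: "v - of_nat (a j) * u \<noteq> 0" if "j \<in> {1..r}" for j
    using v that by (metis finite_atLeastAtMost mult_zero_right prod_zero_iff zero_neq_one)
  then have "(\<Prod>j=1..r. (v - of_nat (a j) * u) ^ a j) \<noteq> 0" by simp
  then have "u ^ (s + 1) \<noteq> 0" unfolding u by simp
  then have nzu: "u \<noteq> 0" by auto
  have W: "(\<Prod>k=1..r. w k ^ a k) = (\<Prod>j=1..r. (v - of_nat (a j) * u) ^ a j)"
    unfolding w_def by (intro prod.cong) auto
  have Z: "(\<Prod>k=1..s. z k) = u ^ s" unfolding z_def by simp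
  have "(\<Prod>k=1..r. w k) = (\<Prod>j=1..r. v - of_nat (a j) * u)"
    unfolding w_def by (intro prod.cong) auto
  then have V: "1 / (\<Prod>k=1..r. w k) = v"
    using v by (metis mult_zero_right nonzero_eq_divide_eq zero_neq_one)
  have U: "of_real (exp t) * (\<Prod>k=1..r. w k ^ a k) / (\<Prod>k=1..s. z k) = u"
    unfolding W Z u[symmetric] using nzu by simp
  have "(z, w) \<in> LG_crit s r a t"
    unfolding LG_crit_iff U V using nzu nzw by (auto simp: z_def w_def cstar_pow_def)
  moreover have "p = Theta s r a (z, w)"
  proof -
    have "(\<Prod>k=1..r. w k ^ a k) / (\<Prod>k=1..s. z k) = of_real (exp (- t)) * u"
      unfolding U[symmetric] by (simp add: exp_minus field_simps)
    then have "Theta s r a (z, w) = (sgn (of_real (exp (- t)) * u), sgn v)"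
      unfolding Theta_def arg_map_def case_prod_conv V by (simp add: sgn_eq)
    then show ?thesis
      by (simp add: p sgn_mult sgn_of_real)
  qed
  ultimately show "p \<in> Theta s r a ` LG_crit s r a t" by blast
qed


section \<open>Exact parametrisation of the solutions with small ratio\<close>

text \<open>
  The logarithm of \<open>\<Prod> (1 - a\<^sub>j x)^b\<^sub>j\<close> on a disc small enough that every factor stays in the
  right half-plane. It is used with \<open>b = 1\<close> and \<open>b = a\<close>, the two products in the reduced system.
\<close>

definition log_factors :: "nat \<Rightarrow> (nat \<Rightarrow> nat) \<Rightarrow> (nat \<Rightarrow> nat) \<Rightarrow> complex \<Rightarrow> complex" where
  "log_factors r a b x = (\<Sum>j=1..r. of_nat (b j) * Ln (1 - of_nat (a j) * x))"

lemma Re_factor_pos: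
  assumes "n \<le> s" "cmod x * (of_nat s + 1) < 1"
  shows "Re (1 - of_nat n * x) > 0"
proof -
  have "Re (of_nat n * x) \<le> cmod (of_nat n * x)" by (rule complex_Re_le_cmod)
  also have "\<dots> = of_nat n * cmod x" by (simp add: norm_mult)
  also have "\<dots> \<le> of_nat s * cmod x" using assms(1) by (intro mult_right_mono) auto
  also have "\<dots> \<le> cmod x * (of_nat s + 1)" by (simp add: algebra_simps)
  finally show ?thesis using assms(2) by simp
qed

lemma exp_log_factors:
  assumes "\<forall>j\<in>{1..r}. a j \<le> s" "cmod x * (of_nat s + 1) < 1"
  shows "exp (log_factors r a b x) = (\<Prod>j=1..r. (1 - of_nat (a j) * x) ^ b j)"
proof -
  have "exp (of_nat (b j) * Ln (1 - of_nat (a j) * x)) = (1 - of_nat (a j) * x) ^ b j"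
    if "j \<in> {1..r}" for j
  proof -
    have "Re (1 - of_nat (a j) * x) > 0"
      using Re_factor_pos assms that by blast
    then have "1 - of_nat (a j) * x \<noteq> 0" by (metis less_irrefl zero_complex.sel(1))
    then show ?thesis unfolding exp_of_nat_mult by (subst exp_Ln) auto
  qed
  then show ?thesis
    unfolding log_factors_def exp_sum[OF finite_atLeastAtMost] by (rule prod.cong[OF refl])
qed

lemma continuous_on_log_factors:
  assumes "\<forall>j\<in>{1..r}. a j \<le> s" "\<forall>x\<in>S. cmod x * (of_nat s + 1) < 1"
  shows "continuous_on S (log_factors r a b)"
proof -
  have "1 - of_nat (a j) * x \<notin> \<real>\<^sub>\<le>\<^sub>0" if "j \<in> {1..r}" "x \<in> S" for j x
    using Re_factor_pos[of "a j" s x] assms that by (metis complex_nonpos_Reals_iff not_le)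
  then show ?thesis
    unfolding log_factors_def by (intro continuous_intros) auto
qed

text \<open>
  With \<open>u = x v\<close> the second reduced equation becomes \<open>v^(r+1) exp L = 1\<close> and the first one
  \<open>u^(s+1) = \<epsilon> v^A exp M\<close>, where \<open>L\<close> and \<open>M\<close> are the logarithms for \<open>b = 1\<close> and \<open>b = a\<close>. The
  next two functions of \<open>x\<close> are the logarithmic corrections by which \<open>v\<close> and \<open>u\<close> then deviate
  from an exact \<open>(r+1)\<close>-st root of unity \<open>\<beta>\<close> and from \<open>\<delta>\<close> times an exact \<open>(s+1)\<close>-st root of
  \<open>\<beta>^A\<close>, where \<open>\<epsilon> = \<delta>^(s+1)\<close>.
\<close>

definition v_exponent :: "nat \<Rightarrow> (nat \<Rightarrow> nat) \<Rightarrow> complex \<Rightarrow> complex" where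
  "v_exponent r a x = - log_factors r a (\<lambda>_. 1) x / of_nat (r + 1)"

definition u_exponent :: "nat \<Rightarrow> nat \<Rightarrow> (nat \<Rightarrow> nat) \<Rightarrow> complex \<Rightarrow> complex" where
  "u_exponent s r a x =
     (log_factors r a a x + of_nat (\<Sum>j=1..r. a j) * v_exponent r a x) / of_nat (s + 1)"

lemma exponents_0 [simp]: "v_exponent r a 0 = 0" "u_exponent s r a 0 = 0"
  by (simp_all add: v_exponent_def u_exponent_def log_factors_def)

lemma continuous_on_exponents:
  assumes "\<forall>j\<in>{1..r}. a j \<le> s" "\<forall>x\<in>S. cmod x * (of_nat s + 1) < 1"
  shows "continuous_on S (v_exponent r a)" "continuous_on S (u_exponent s r a)"
proof -
  note c = continuous_on_log_factors[OF assms]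
  have "of_nat (r + 1) \<noteq> (0::complex)" "of_nat (s + 1) \<noteq> (0::complex)"
    by (simp_all del: of_nat_add of_nat_Suc)
  then show v: "continuous_on S (v_exponent r a)"
    unfolding v_exponent_def by (intro continuous_intros c) blast
  then show "continuous_on S (u_exponent s r a)"
    unfolding u_exponent_def using \<open>of_nat (s + 1) \<noteq> (0::complex)\<close> by (intro continuous_intros c v) blast
qed

text \<open>
  The exponents are chosen so that all dependence on \<open>x\<close> cancels: \<open>v \<Prod> (v - a\<^sub>j u)\<close> equals
  \<open>\<beta>^(r+1)\<close>, and both sides of the other equation carry the same exponential factor. One
  equivalence serves both directions of the Hausdorff estimate.
\<close>

lemma reduced_sols_iff_root_pairs:
  assumes a: "\<forall>j\<in>{1..r}. a j \<le> s" and x: "cmod x * (of_nat s + 1) < 1"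
    and "\<delta> > 0" and u: "u = of_real \<delta> * \<alpha> * exp (u_exponent s r a x)"
    and v: "v = \<beta> * exp (v_exponent r a x)" and uv: "u = x * v"
  shows "(u, v) \<in> reduced_sols s r a (\<delta> ^ (s + 1)) \<longleftrightarrow> (\<alpha>, \<beta>) \<in> root_pairs s r (\<Sum>j=1..r. a j)"
proof -
  let ?A = "\<Sum>j=1..r. a j"
  let ?L = "log_factors r a (\<lambda>_. 1) x" and ?M = "log_factors r a a x"
  have nz: "of_nat (r + 1) \<noteq> (0::complex)" "of_nat (s + 1) \<noteq> (0::complex)"
    by (simp_all del: of_nat_add of_nat_Suc)
  have w: "v - of_nat (a j) * u = v * (1 - of_nat (a j) * x)" for j
    by (simp add: uv algebra_simps)
  have "(\<Prod>j=1..r. v - of_nat (a j) * u) = v ^ r * exp ?L"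
    unfolding w exp_log_factors[OF a x] by (simp add: prod.distrib)
  then have "v * (\<Prod>j=1..r. v - of_nat (a j) * u) = v ^ (r + 1) * exp ?L" by simp
  also have "v ^ (r + 1) = \<beta> ^ (r + 1) * exp (- ?L)"
  proof -
    have "of_nat (r + 1) * v_exponent r a x = - ?L"
      using nz unfolding v_exponent_def by (metis nonzero_mult_div_cancel_left times_divide_eq_right)
    then show ?thesis unfolding v power_mult_distrib exp_of_nat_mult[symmetric] by simp
  qed
  finally have 1: "v * (\<Prod>j=1..r. v - of_nat (a j) * u) = \<beta> ^ (r + 1)"
    by (simp add: exp_minus)
  have "(\<Prod>j=1..r. (v - of_nat (a j) * u) ^ a j) = v ^ ?A * exp ?M"
    unfolding w exp_log_factors[OF a x] by (simp add: prod.distrib power_mult_distrib power_sum)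
  also have "v ^ ?A = \<beta> ^ ?A * exp (of_nat ?A * v_exponent r a x)"
    unfolding v power_mult_distrib exp_of_nat_mult ..
  finally have 2: "(\<Prod>j=1..r. (v - of_nat (a j) * u) ^ a j) =
      \<beta> ^ ?A * exp (?M + of_nat ?A * v_exponent r a x)"
    by (simp add: exp_add mult.commute)
  have "of_nat (s + 1) * u_exponent s r a x = ?M + of_nat ?A * v_exponent r a x"
    using nz unfolding u_exponent_def by (metis nonzero_mult_div_cancel_left times_divide_eq_right)
  then have 3: "u ^ (s + 1) =
      of_real (\<delta> ^ (s + 1)) * \<alpha> ^ (s + 1) * exp (?M + of_nat ?A * v_exponent r a x)"
    unfolding u power_mult_distrib exp_of_nat_mult[symmetric] of_real_power by simp
  have "of_real (\<delta> ^ (s + 1)) \<noteq> (0::complex)" using \<open>\<delta> > 0\<close> by simp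
  then show ?thesis
    unfolding reduced_sols_def root_pairs_def mem_Collect_eq case_prod_conv 1 2 3
    by (simp del: power_Suc)
qed

section \<open>A priori bound on the ratio\<close>

text \<open>
  Put \<open>B = |v| + s |u|\<close>, which bounds \<open>|v|\<close> and all \<open>|v - a\<^sub>j u|\<close>. The second equation forces
  \<open>B \<ge> 1\<close>, so in the first equation \<open>B^A\<close> may be replaced by \<open>B^(s+1)\<close>, and taking
  \<open>(s+1)\<close>-st roots gives the bound.
\<close>

lemma reduced_sols_norm_le:
  assumes sol: "(u, v) \<in> reduced_sols s r a (\<delta> ^ (s + 1))"
    and "\<delta> \<ge> 0" and A: "(\<Sum>j=1..r. a j) \<le> s"
  shows "cmod u \<le> \<delta> * (cmod v + of_nat s * cmod u)"
proof -
  let ?B = "cmod v + of_nat s * cmod u"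
  have w: "cmod (v - of_nat (a j) * u) \<le> ?B" if "j \<in> {1..r}" for j
  proof -
    have "a j \<le> s" using member_le_sum[OF that, of a] A by simp
    then have "cmod (of_nat (a j) * u) \<le> of_nat s * cmod u"
      by (simp add: norm_mult mult_right_mono)
    then show ?thesis using norm_triangle_ineq4[of v "of_nat (a j) * u"] by simp
  qed
  have "1 = cmod v * (\<Prod>j=1..r. cmod (v - of_nat (a j) * u))"
  proof -
    have "v * (\<Prod>j=1..r. v - of_nat (a j) * u) = 1"
      using sol by (simp add: reduced_sols_def)
    then show ?thesis
      unfolding prod_norm norm_mult[symmetric] by (metis norm_one)
  qed
  also have "\<dots> \<le> ?B * (\<Prod>j=1..r. ?B)"
    using w by (intro mult_mono prod_mono prod_nonneg) auto
  finally have "1 \<le> ?B ^ (r + 1)" by simp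
  then have B: "1 \<le> ?B"
    by (metis add_nonneg_nonneg linorder_not_le mult_nonneg_nonneg norm_ge_zero of_nat_0_le_iff
        power_less_one_iff zero_less_Suc Suc_eq_plus1)
  have "cmod u ^ (s + 1) = \<delta> ^ (s + 1) * (\<Prod>j=1..r. cmod (v - of_nat (a j) * u) ^ a j)"
  proof -
    have "u ^ (s + 1) = of_real (\<delta> ^ (s + 1)) * (\<Prod>j=1..r. (v - of_nat (a j) * u) ^ a j)"
      using sol by (simp add: reduced_sols_def)
    then have "cmod u ^ (s + 1) =
        cmod (of_real (\<delta> ^ (s + 1)) * (\<Prod>j=1..r. (v - of_nat (a j) * u) ^ a j))"
      by (metis norm_power)
    then show ?thesis
      unfolding norm_mult norm_of_real prod_norm[symmetric] norm_power using \<open>\<delta> \<ge> 0\<close> by simp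
  qed
  also have "\<dots> \<le> \<delta> ^ (s + 1) * (\<Prod>j=1..r. ?B ^ a j)"
    using w \<open>\<delta> \<ge> 0\<close> by (intro mult_left_mono prod_mono) (auto intro!: power_mono)
  also have "\<dots> = \<delta> ^ (s + 1) * ?B ^ (\<Sum>j=1..r. a j)" by (simp add: power_sum)
  also have "\<dots> \<le> \<delta> ^ (s + 1) * ?B ^ (s + 1)"
    using A B \<open>\<delta> \<ge> 0\<close> by (intro mult_left_mono power_increasing) auto
  finally have "cmod u ^ (s + 1) \<le> (\<delta> * ?B) ^ (s + 1)" by (simp only: power_mult_distrib)
  then have "cmod u ^ Suc s \<le> (\<delta> * ?B) ^ Suc s" by (simp only: Suc_eq_plus1)
  moreover have "0 \<le> \<delta> * ?B"
    using \<open>\<delta> \<ge> 0\<close> by (intro mult_nonneg_nonneg) auto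
  ultimately show ?thesis by (rule power_le_imp_le_base)
qed

text \<open>
  The implicit bound solved for \<open>|u| / |v|\<close>; the hypothesis on \<open>\<delta>\<close> says that \<open>s \<delta> < 1\<close> and
  \<open>\<delta> / (1 - s \<delta>) \<le> \<eta>\<close>.
\<close>

lemma reduced_sols_ratio_small:
  assumes sol: "(u, v) \<in> reduced_sols s r a (\<delta> ^ (s + 1))"
    and "\<delta> \<ge> 0" and A: "(\<Sum>j=1..r. a j) \<le> s"
    and "\<eta> > 0" and \<delta>: "\<delta> * (1 + of_nat s * \<eta>) \<le> \<eta>"
  shows "cmod (u / v) \<le> \<eta>"
proof -
  have "v \<noteq> 0" using sol by (auto simp: reduced_sols_def)
  have "\<delta> * of_nat s < 1"
  proof (cases "\<delta> = 0")
    case False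
    then have "\<eta> * (\<delta> * of_nat s) < \<eta> * 1" using \<delta> \<open>\<delta> \<ge> 0\<close> by (simp add: algebra_simps)
    then show ?thesis using \<open>\<eta> > 0\<close> mult_less_cancel_left_pos by blast
  qed simp
  have "(1 - \<delta> * of_nat s) * cmod u \<le> \<delta> * cmod v"
    using reduced_sols_norm_le[OF sol \<open>\<delta> \<ge> 0\<close> A] by (simp add: algebra_simps)
  also have "\<dots> \<le> ((1 - \<delta> * of_nat s) * \<eta>) * cmod v"
    using \<delta> by (intro mult_right_mono) (auto simp: algebra_simps)
  finally have "cmod u \<le> \<eta> * cmod v"
    using \<open>\<delta> * of_nat s < 1\<close> by (simp add: mult.assoc)
  then show ?thesis using \<open>v \<noteq> 0\<close> by (simp add: norm_divide field_simps)
qed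

section \<open>Existence of a solution near every limit point\<close>

text \<open>
  If \<open>(\<alpha>, \<beta>)\<close> is prescribed and \<open>c = \<alpha> / \<beta>\<close>, then \<open>x = u / v\<close> is the remaining consistency
  condition in the parametrisation, and it has the form \<open>x = \<delta> c g(x)\<close> with \<open>g\<close> continuous. For
  small \<open>\<delta>\<close> the right-hand side maps the disc of radius \<open>\<eta>\<close> into itself, so Brouwer's theorem
  applies. The bound on \<open>\<delta>\<close> does not depend on \<open>c\<close>.
\<close>

lemma small_fixed_point:
  assumes a: "\<forall>j\<in>{1..r}. a j \<le> s" and \<eta>: "0 < \<eta>" "\<eta> * (of_nat s + 1) < 1"
  shows "\<exists>\<delta>0>0. \<forall>\<delta> c. 0 \<le> \<delta> \<and> \<delta> \<le> \<delta>0 \<and> cmod c = 1 \<longrightarrow>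
    (\<exists>x\<in>cball 0 \<eta>. of_real \<delta> * c * exp (u_exponent s r a x - v_exponent r a x) = x)"
proof -
  define g where "g = (\<lambda>x::complex. exp (u_exponent s r a x - v_exponent r a x))"
  have "\<forall>x\<in>cball 0 \<eta>. cmod x * (of_nat s + 1) < 1"
  proof
    fix x :: complex assume "x \<in> cball 0 \<eta>"
    then have "cmod x * (of_nat s + 1) \<le> \<eta> * (of_nat s + 1)" by (intro mult_right_mono) auto
    then show "cmod x * (of_nat s + 1) < 1" using \<eta>(2) by (rule le_less_trans)
  qed
  then have g: "continuous_on (cball 0 \<eta>) g"
    unfolding g_def by (intro continuous_intros continuous_on_exponents[OF a])
  then have "bounded (g ` cball 0 \<eta>)"
    by (intro compact_imp_bounded compact_continuous_image) auto
  then obtain C where C: "C > 0" "\<And>x::complex. x \<in> cball 0 \<eta> \<Longrightarrow> cmod (g x) \<le> C"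
    by (auto simp: bounded_pos)
  have "\<exists>x\<in>cball (0::complex) \<eta>. of_real \<delta> * c * g x = x" if \<delta>: "0 \<le> \<delta>" "\<delta> \<le> \<eta> / C" and c: "cmod c = 1"
    for \<delta> :: real and c :: complex
  proof (rule brouwer_ball[OF \<eta>(1)])
    show "continuous_on (cball 0 \<eta>) (\<lambda>x. of_real \<delta> * c * g x)" by (intro continuous_intros g)
    show "(\<lambda>x. of_real \<delta> * c * g x) \<in> cball 0 \<eta> \<rightarrow> cball 0 \<eta>"
    proof
      fix x :: complex assume "x \<in> cball 0 \<eta>"
      then have "\<delta> * cmod (g x) \<le> \<eta> / C * C" using \<delta> C by (intro mult_mono) auto
      then show "of_real \<delta> * c * g x \<in> cball 0 \<eta>" using \<delta> c C(1) by (simp add: norm_mult)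
    qed
  qed blast
  then show ?thesis
    unfolding g_def using \<eta>(1) C(1) by (intro exI[of _ "\<eta> / C"]) auto
qed

section \<open>Convergence of the phases\<close>

text \<open>
  The positive factor \<open>\<delta>\<close> does not affect phases, and multiplication by \<open>\<alpha>\<close> and by \<open>\<beta>\<close> are
  isometries. So the distance to the limit point is a quantity that is small for small exponents,
  whichever limit point is considered.
\<close>

lemma dist_rotated_phases:
  assumes "(\<alpha>, \<beta>) \<in> root_pairs s r A" "\<delta> > 0"
  shows "dist (map_prod sgn sgn (of_real \<delta> * \<alpha> * exp p, \<beta> * exp q)) (\<alpha>, \<beta>)
       = dist (sgn (exp p), sgn (exp q)) (1, 1)"
proof -
  note n = norm_root_pairs[OF assms(1)]
  have d: "dist (c * z) c = dist z 1" if "cmod c = 1" for c z :: complex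
    using that by (metis dist_norm mult.right_neutral mult_1 norm_mult right_diff_distrib)
  have "sgn \<alpha> = \<alpha>" "sgn \<beta> = \<beta>"
    using n by (simp_all add: sgn_eq)
  then have "sgn (of_real \<delta> * \<alpha> * exp p) = \<alpha> * sgn (exp p)" "sgn (\<beta> * exp q) = \<beta> * sgn (exp q)"
    using assms(2) by (simp_all add: sgn_mult sgn_of_real)
  then show ?thesis
    by (simp only: map_prod_simp dist_Pair_Pair d[OF n(1)] d[OF n(2)])
qed

lemma phases_near_1:
  assumes a: "\<forall>j\<in>{1..r}. a j \<le> s" and "e > 0"
  obtains \<eta> where "\<eta> > 0" "\<eta> * (of_nat s + 1) < 1"
    "\<And>x. cmod x \<le> \<eta> \<Longrightarrow>
      dist (sgn (exp (u_exponent s r a x)), sgn (exp (v_exponent r a x))) (1, 1) < e"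
proof -
  define S where "S = ball (0::complex) (1 / (of_nat s + 1))"
  have S: "\<forall>x\<in>S. cmod x * (of_nat s + 1) < 1"
  proof
    fix x assume "x \<in> S"
    then have "cmod x < 1 / (of_nat s + 1)" by (simp only: S_def mem_ball_0)
    then show "cmod x * (of_nat s + 1) < 1"
      by (subst (asm) pos_less_divide_eq) (simp_all add: add_nonneg_pos)
  qed
  define \<phi> where "\<phi> = (\<lambda>x. (sgn (exp (u_exponent s r a x)), sgn (exp (v_exponent r a x))))"
  have "continuous_on S \<phi>"
    unfolding \<phi>_def sgn_eq
    by (intro continuous_intros continuous_on_exponents[OF a S]) auto
  moreover have "0 \<in> S" unfolding S_def by (simp add: add_nonneg_pos)
  ultimately have "\<phi> \<midarrow>0\<rightarrow> \<phi> 0"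
    using continuous_on_eq_continuous_at[of S \<phi>] by (auto simp: S_def isCont_def)
  moreover have "\<phi> 0 = (1, 1)" by (simp add: \<phi>_def)
  ultimately obtain d where d: "d > 0" "\<And>x. x \<noteq> 0 \<Longrightarrow> cmod x < d \<Longrightarrow> dist (\<phi> x) (1, 1) < e"
    using \<open>e > 0\<close> by (auto simp: LIM_def)
  have near: "dist (\<phi> x) (1, 1) < e" if "cmod x < d" for x
    using d(2)[of x] that \<open>\<phi> 0 = (1, 1)\<close> \<open>e > 0\<close> by (cases "x = 0") auto
  define \<eta> where "\<eta> = min (d / 2) (1 / (2 * (of_nat s + 1)))"
  show thesis
  proof
    show "\<eta> > 0" using d by (simp add: \<eta>_def)
    have "\<eta> * (of_nat s + 1) \<le> 1 / (2 * (of_nat s + 1)) * (of_nat s + 1)"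
      unfolding \<eta>_def by (intro mult_right_mono) auto
    also have "\<dots> = 1 / 2"
    proof -
      have "of_nat s + 1 \<noteq> (0::real)" by linarith
      then show ?thesis by (simp add: divide_simps)
    qed
    finally show "\<eta> * (of_nat s + 1) < 1" by (rule le_less_trans) simp
    fix x assume "cmod x \<le> \<eta>"
    then have "cmod x < d" using d(1) by (simp add: \<eta>_def)
    then show "dist (sgn (exp (u_exponent s r a x)), sgn (exp (v_exponent r a x))) (1, 1) < e"
      using near unfolding \<phi>_def by blast
  qed
qed

text \<open>
  Here \<open>\<delta> ^ (s + 1)\<close> takes the place of \<open>e\<^sup>t\<close>, so that no roots have to be extracted.
\<close>

lemma hausdorff_dist_reduced_sols:
  assumes A: "(\<Sum>j=1..r. a j) \<le> s" and "e > 0"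
  shows "\<exists>\<delta>0>0. \<forall>\<delta>. 0 < \<delta> \<and> \<delta> \<le> \<delta>0 \<longrightarrow>
    hausdorff_dist (map_prod sgn sgn ` reduced_sols s r a (\<delta> ^ (s + 1)))
      (root_pairs s r (\<Sum>j=1..r. a j)) \<le> ennreal e"
proof -
  let ?A = "\<Sum>j=1..r. a j"
  have a: "\<forall>j\<in>{1..r}. a j \<le> s"
    using member_le_sum[of _ "{1..r}" a] A by fastforce
  obtain \<eta> where \<eta>: "\<eta> > 0" "\<eta> * (of_nat s + 1) < 1"
    and near: "\<And>x. cmod x \<le> \<eta> \<Longrightarrow>
      dist (sgn (exp (u_exponent s r a x)), sgn (exp (v_exponent r a x))) (1, 1) < e"
    using phases_near_1[OF a \<open>e > 0\<close>] by blast
  have small: "cmod x * (of_nat s + 1) < 1" if "cmod x \<le> \<eta>" for x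
    by (rule le_less_trans[OF mult_right_mono[OF that] \<eta>(2)]) simp
  obtain \<delta>1 where \<delta>1: "\<delta>1 > 0" and fixpt: "\<And>\<delta> c. 0 \<le> \<delta> \<Longrightarrow> \<delta> \<le> \<delta>1 \<Longrightarrow> cmod c = 1 \<Longrightarrow>
    \<exists>x\<in>cball 0 \<eta>. of_real \<delta> * c * exp (u_exponent s r a x - v_exponent r a x) = x"
    using small_fixed_point[OF a \<eta>] by blast
  \<comment> \<open>The first bound yields fixed points, the second is the hypothesis of the a priori bound.\<close>
  define \<delta>0 where "\<delta>0 = min \<delta>1 (\<eta> / (1 + of_nat s * \<eta>))"
  have pos: "1 + of_nat s * \<eta> > 0" using \<eta>(1) by (intro add_pos_nonneg) auto
  have "\<delta>0 > 0" using \<delta>1 \<eta>(1) pos by (simp add: \<delta>0_def)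
  moreover have "hausdorff_dist (map_prod sgn sgn ` reduced_sols s r a (\<delta> ^ (s + 1)))
      (root_pairs s r ?A) \<le> ennreal e" if \<delta>: "0 < \<delta>" "\<delta> \<le> \<delta>0" for \<delta>
  proof (rule hausdorff_dist_le)
    fix p assume "p \<in> map_prod sgn sgn ` reduced_sols s r a (\<delta> ^ (s + 1))"
    then obtain u v where sol: "(u, v) \<in> reduced_sols s r a (\<delta> ^ (s + 1))"
      and p: "p = map_prod sgn sgn (u, v)" by auto
    define x where "x = u / v"
    have "\<delta> * (1 + of_nat s * \<eta>) \<le> \<eta>" using \<delta> pos by (simp add: \<delta>0_def pos_le_divide_eq)
    then have x: "cmod x \<le> \<eta>"
      unfolding x_def using reduced_sols_ratio_small[OF sol _ A \<eta>(1)] \<delta> by simp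
    \<comment> \<open>Divide off the corrections to find the limit point to which the solution belongs.\<close>
    define \<beta> where "\<beta> = v / exp (v_exponent r a x)"
    define \<alpha> where "\<alpha> = u / (of_real \<delta> * exp (u_exponent s r a x))"
    have u: "u = of_real \<delta> * \<alpha> * exp (u_exponent s r a x)" and v: "v = \<beta> * exp (v_exponent r a x)"
      using \<delta> by (simp_all add: \<alpha>_def \<beta>_def)
    have "u = x * v" using sol by (auto simp: x_def reduced_sols_def)
    then have R: "(\<alpha>, \<beta>) \<in> root_pairs s r ?A"
      using reduced_sols_iff_root_pairs[OF a small[OF x] \<delta>(1) u v] sol by blast
    have "dist p (\<alpha>, \<beta>) < e"
      unfolding p u v dist_rotated_phases[OF R \<delta>(1)] by (rule near[OF x])
    then show "\<exists>y\<in>root_pairs s r ?A. dist p y \<le> e" using R by force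
  next
    fix y assume "y \<in> root_pairs s r ?A"
    then obtain \<alpha> \<beta> where y: "y = (\<alpha>, \<beta>)" and R: "(\<alpha>, \<beta>) \<in> root_pairs s r ?A"
      by (cases y) auto
    have \<beta>: "\<beta> \<noteq> 0" and n: "cmod (\<alpha> / \<beta>) = 1" using norm_root_pairs[OF R] by (auto simp: norm_divide)
    obtain x where x: "cmod x \<le> \<eta>"
      and fx: "of_real \<delta> * (\<alpha> / \<beta>) * exp (u_exponent s r a x - v_exponent r a x) = x"
      using fixpt[OF _ _ n, of \<delta>] \<delta> by (auto simp: \<delta>0_def)
    define u where "u = of_real \<delta> * \<alpha> * exp (u_exponent s r a x)"
    define v where "v = \<beta> * exp (v_exponent r a x)"
    have "x * v = u"
      unfolding u_def v_def by (subst fx[symmetric]) (use \<beta> in \<open>simp add: exp_diff\<close>)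
    then have "(u, v) \<in> reduced_sols s r a (\<delta> ^ (s + 1))"
      using reduced_sols_iff_root_pairs[OF a small[OF x] \<delta>(1) u_def v_def] R by blast
    moreover have "dist (map_prod sgn sgn (u, v)) y < e"
      unfolding y u_def v_def dist_rotated_phases[OF R \<delta>(1)] by (rule near[OF x])
    ultimately show "\<exists>p\<in>map_prod sgn sgn ` reduced_sols s r a (\<delta> ^ (s + 1)). dist p y \<le> e"
      by force
  qed
  ultimately show ?thesis by blast
qed

theorem theoremA:
  fixes r s :: nat and a :: "nat \<Rightarrow> nat"
  assumes "r \<ge> 1" and "s \<ge> 1"
    and "mono_on {1..r} a"
    and "(\<Sum>i=1..r. a i) \<le> s"
  shows "limit_set s r a \<subseteq> torus2 \<and>
    ((\<lambda>t::real. hausdorff_dist (Theta s r a ` LG_crit s r a t) (limit_set s r a)) \<longlongrightarrow> 0) at_bot"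
proof
  show "limit_set s r a \<subseteq> torus2"
    unfolding limit_set_eq_root_pairs torus2_def using norm_root_pairs by auto
  show "((\<lambda>t::real. hausdorff_dist (Theta s r a ` LG_crit s r a t) (limit_set s r a)) \<longlongrightarrow> 0) at_bot"
  proof (rule order_tendstoI)
    fix b :: ennreal assume "0 < b"
    then obtain q where q: "0 < q" "q < b" using dense by blast
    then obtain e where e: "e > 0" "ennreal e < b" by (cases q) auto
    obtain \<delta>0 where \<delta>0: "\<delta>0 > 0" and close: "\<And>\<delta>. 0 < \<delta> \<Longrightarrow> \<delta> \<le> \<delta>0 \<Longrightarrow>
      hausdorff_dist (map_prod sgn sgn ` reduced_sols s r a (\<delta> ^ (s + 1)))
        (root_pairs s r (\<Sum>j=1..r. a j)) \<le> ennreal e"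
      using hausdorff_dist_reduced_sols[OF assms(4) e(1)] by blast
    have "\<forall>\<^sub>F t in at_bot. t \<le> of_nat (s + 1) * ln \<delta>0"
      by (rule eventually_le_at_bot)
    then show "\<forall>\<^sub>F t in at_bot. hausdorff_dist (Theta s r a ` LG_crit s r a t) (limit_set s r a) < b"
    proof eventually_elim
      case (elim t)
      define \<delta> where "\<delta> = exp (t / of_nat (s + 1))"
      have "t / of_nat (s + 1) \<le> ln \<delta>0"
        using elim by (simp add: field_simps)
      then have "\<delta> \<le> \<delta>0" unfolding \<delta>_def using \<delta>0 by (metis exp_le_cancel_iff exp_ln)
      moreover have "\<delta> ^ (s + 1) = exp t"
        unfolding \<delta>_def exp_of_nat_mult[symmetric] by simp
      moreover have "\<delta> > 0" by (simp add: \<delta>_def)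
      ultimately show ?case
        using close[of \<delta>] e(2) unfolding Theta_LG_crit limit_set_eq_root_pairs by simp
    qed
  qed simp
qed

end
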